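(* The only Fibonacci number $F_n$ that can be expressed in the form $F_n = 5x^2$ for some $x \in \mathbb{Z}$ is when $n = 5$, $x = 1$.
   Context: $F_n$ denotes the $n$-th Fibonacci number, where $F_0=0$, $F_1=1$, and $F_{n+2}=F_{n+1}+F_n$ for all $n\ge 0$.
   Formalization: Read literally the claim fails, since F_0 = 0 = 5·0² and F_5 = 5·(−1)²; the formal statement says the solutions of F_n = 5x² with n ≥ 0, x ∈ ℤ are exactly n = 0, x = 0 and n = 5, x = ±1. *)

theory Defs
  imports "HOL-Number_Theory.Fib"
begin

end

theory Submission
  imports Defs "HOL-Computational_Algebra.Nth_Powers"
begin

text \<open>
  For odd \<open>n \<noteq> 5\<close> follow Cohn: one of \<open>n \<plusminus> 5\<close> is a multiple of 4, say \<open>2 k t\<close> with \<open>k\<close> even,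
  \<open>3 \<nmid> k\<close> and \<open>t\<close> a power of 3. Shifting the index by \<open>2 k t\<close> changes the sign of Fibonacci numbers
  modulo the Lucas number \<open>L\<^sub>k\<close>, so \<open>5 x\<^sup>2 \<equiv> -5\<close> modulo \<open>L\<^sub>k\<close>; but \<open>-1\<close> is not a square
  modulo \<open>L\<^sub>k \<equiv> 3 (mod 4)\<close>. For even \<open>n = 2 m\<close> descend, splitting \<open>F\<^sub>n = F\<^sub>m L\<^sub>m\<close> into nearly
  coprime factors subject to \<open>L\<^sub>m\<^sup>2 = 5 F\<^sub>m\<^sup>2 \<plusminus> 4\<close>.
\<close>

section \<open>Minus one as a quadratic residue, and coprime factors of squares\<close>

text \<open>Descent on \<open>m\<close> through the cofactor replaces the usual choice of a prime
  factor congruent to 3 modulo 4.\<close>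

lemma not_dvd_square_add_one_of_mod_4_eq_3:
  fixes m x :: int
  assumes "m > 0" "m mod 4 = 3"
  shows "\<not> m dvd x\<^sup>2 + 1"
  using assms
proof (induction "nat m" arbitrary: m x rule: less_induct)
  case less
  show ?case
  proof
    assume dvd: "m dvd x\<^sup>2 + 1"
    \<comment> \<open>An even square root of \<open>-1\<close> below \<open>m\<close> makes the cofactor a smaller divisor congruent to 3.\<close>
    obtain y where y: "0 \<le> y" "y < m" "even y" "m dvd y\<^sup>2 + 1"
    proof -
      define r where "r = x mod m"
      have r: "0 \<le> r" "r < m" using less.prems by (auto simp: r_def)
      have "(r\<^sup>2 + 1) mod m = (x\<^sup>2 + 1) mod m"
        unfolding r_def by (metis mod_add_left_eq power_mod)
      then have dr: "m dvd r\<^sup>2 + 1" using dvd by (metis dvd_eq_mod_eq_0)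
      show ?thesis
      proof (cases "even r")
        case True
        then show ?thesis using r dr that by blast
      next
        case False
        \<comment> \<open>Since \<open>m\<close> is odd, \<open>m - r\<close> has the opposite
          parity to \<open>r\<close>.\<close>
        have "(m - r)\<^sup>2 + 1 = m * (m - 2 * r) + (r\<^sup>2 + 1)"
          by (simp add: power2_eq_square algebra_simps)
        then have "m dvd (m - r)\<^sup>2 + 1" using dr by (metis dvd_add dvd_triv_left)
        moreover have "odd m" using less.prems by presburger
        moreover have "r > 0" using r False by (cases "r = 0") auto
        ultimately show ?thesis using that[of "m - r"] r False by simp
      qed
    qed
    then obtain c where c: "y\<^sup>2 + 1 = m * c" by blast
    have "m \<ge> 3" using less.prems by presburger
    have "m * c > 0" using c by (metis zero_le_power2 add_nonneg_pos zero_less_one)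
    then have "c > 0" using less.prems by (simp add: zero_less_mult_iff)
    have "y\<^sup>2 \<le> (m - 1)\<^sup>2" using y by (intro power_mono) auto
    then have "y\<^sup>2 + 1 < m * m" using \<open>m \<ge> 3\<close> by (simp add: power2_eq_square algebra_simps)
    then have "m * c < m * m" using c by simp
    then have "c < m" using less.prems by simp
    obtain z where z: "y = 2 * z" using y by blast
    obtain q where q: "m = 4 * q + 3" using less.prems by (metis mult_div_mod_eq)
    \<comment> \<open>Modulo 4 this says that \<open>3 * c\<close> is congruent to 1.\<close>
    have "4 * (z\<^sup>2) + 1 = 4 * (q * c) + 3 * c" using c z q by (simp add: power2_eq_square algebra_simps)
    then have "c mod 4 = 3" by presburger
    moreover have "c dvd y\<^sup>2 + 1" using c by simp
    ultimately show False using less.hyps[of c y] \<open>c > 0\<close> \<open>c < m\<close> by auto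
  qed
qed

lemma coprime_mult_eq_square_int:
  fixes a b w :: int
  assumes "coprime a b" "a \<ge> 0" "b \<ge> 0" "a * b = w\<^sup>2"
  obtains s t where "a = s\<^sup>2" "b = t\<^sup>2"
proof -
  have "coprime (nat a) (nat b)" using assms by (metis coprime_int_iff int_nat_eq)
  moreover have "nat a * nat b = (nat \<bar>w\<bar>)\<^sup>2"
    using assms by (metis nat_mult_distrib nat_power_eq abs_ge_zero power2_abs)
  then have "is_nth_power 2 (nat a * nat b)" by simp
  ultimately have "is_nth_power 2 (nat a)" "is_nth_power 2 (nat b)"
    by (auto dest: is_nth_power_mult_coprime_nat_iff[THEN iffD1])
  then obtain s t where "nat a = s\<^sup>2" "nat b = t\<^sup>2" by (auto simp: is_nth_power_def)
  then have "a = (int s)\<^sup>2" "b = (int t)\<^sup>2" using assms by (metis int_nat_eq of_nat_power)+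
  then show ?thesis using that by blast
qed

section \<open>Lucas numbers\<close>

text \<open>This is the usual F_(n-1) + F_(n+1), written without a predecessor so that index 0 needs
  no special case.\<close>

definition lucas :: "nat \<Rightarrow> int" where
  "lucas n = 2 * int (fib (Suc n)) - int (fib n)"

lemma lucas_0 [simp]: "lucas 0 = 2"
  and lucas_1 [simp]: "lucas (Suc 0) = 1"
  and lucas_rec: "lucas (Suc (Suc n)) = lucas (Suc n) + lucas n"
  by (simp_all add: lucas_def)

lemma fib_5: "fib 5 = 5"
  and lucas_5: "lucas 5 = 11"
  by (simp_all add: eval_nat_numeral lucas_rec)

lemma lucas_pos: "lucas n > 0"
  by (induction n rule: fib.induct) (auto simp: lucas_rec)

text \<open>Cassini's identity in norm form: the n-th power of the conjugate of the golden ratio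
  \<phi> is F_(n+1) - F_n \<phi>, and its norm is the n-th power of -1.\<close>

lemma fib_norm:
  "(int (fib (Suc n)))\<^sup>2 - int (fib n) * int (fib (Suc n)) - (int (fib n))\<^sup>2 = (-1) ^ n"
  by (induction n) (simp_all add: power2_eq_square algebra_simps)

text \<open>Complete the square in the norm form. This relation yields the quartic equations of the
  descent.\<close>

lemma lucas_square: "(lucas n)\<^sup>2 = 5 * (int (fib n))\<^sup>2 + 4 * (-1) ^ n"
proof -
  have "(2 * b - a)\<^sup>2 = 5 * a\<^sup>2 + 4 * (b\<^sup>2 - a * b - a\<^sup>2)" for a b :: int
    by (simp add: power2_eq_square algebra_simps)
  then show ?thesis unfolding lucas_def fib_norm[symmetric] .
qed

text \<open>The usual addition formula, with F_(b-1) expanded as F_(b+1) - F_b.\<close>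

lemma fib_add_int:
  "int (fib (a + b)) = int (fib (Suc a)) * int (fib b) + int (fib a) * int (fib (Suc b))
     - int (fib a) * int (fib b)"
  by (induction a rule: fib.induct) (simp_all add: algebra_simps)

lemma fib_double: "int (fib (2 * k)) = int (fib k) * lucas k"
  using fib_add_int[of k k] unfolding lucas_def mult_2 by (simp add: algebra_simps)

lemma fib_Suc_double:
  assumes "even k"
  shows "int (fib (Suc (2 * k))) = int (fib (Suc k)) * lucas k - 1"
proof -
  have "int (fib (Suc (2 * k))) = int (fib (Suc k)) * int (fib (Suc k)) + int (fib k) * int (fib k)"
    using fib_add_int[of "Suc k" k] unfolding mult_2 by (simp add: algebra_simps)
  moreover have "int (fib (Suc k)) * int (fib (Suc k)) - int (fib k) * int (fib (Suc k))
      - int (fib k) * int (fib k) = 1"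
    using fib_norm[of k] assms by (simp add: power2_eq_square)
  moreover have "int (fib (Suc k)) * lucas k
      = 2 * (int (fib (Suc k)) * int (fib (Suc k))) - int (fib k) * int (fib (Suc k))"
    by (simp add: lucas_def algebra_simps)
  ultimately show ?thesis by linarith
qed

text \<open>Modulo \<open>lucas k\<close> the pair at indices \<open>2 * k\<close> and
  \<open>2 * k + 1\<close> is (0, -1), the negative of the initial pair, so the shift by
  \<open>2 * k\<close> negates the sequence.\<close>

lemma lucas_dvd_fib_add:
  assumes "even k"
  shows "lucas k dvd int (fib (a + 2 * k)) + int (fib a)"
proof -
  have "int (fib (a + 2 * k)) + int (fib a)
      = lucas k * (int (fib (Suc a)) * int (fib k) + int (fib a) * int (fib (Suc k))
         - int (fib a) * int (fib k))"
    unfolding fib_add_int[of a] fib_double fib_Suc_double[OF assms] by (simp add: algebra_simps)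
  then show ?thesis by simp
qed

lemma lucas_dvd_fib_add_mult:
  assumes "even k"
  shows "lucas k dvd int (fib (a + 2 * k * t)) - (-1) ^ t * int (fib a)"
proof (induction t)
  case (Suc t)
  have "int (fib (a + 2 * k * Suc t)) - (-1) ^ Suc t * int (fib a)
     = (int (fib ((a + 2 * k * t) + 2 * k)) + int (fib (a + 2 * k * t)))
       - (int (fib (a + 2 * k * t)) - (-1) ^ t * int (fib a))"
    by (simp add: algebra_simps)
  then show ?case
    using Suc lucas_dvd_fib_add[OF assms, of "a + 2 * k * t"] by (metis dvd_diff)
qed simp

text \<open>Modulo 4 the sequence has period 6, namely 2, 1, 3, 0, 3, 3; two consecutive values
  carry the induction.\<close>

lemma lucas_mod_4:
  "lucas (6 * q) mod 4 = 2 \<and> lucas (6 * q + 1) mod 4 = 1"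
proof (induction q)
  case (Suc q)
  \<comment> \<open>The coefficients 5, 8, 13 are F_5, F_6, F_7.\<close>
  have "lucas (6 * Suc q) = 5 * lucas (6 * q) + 8 * lucas (6 * q + 1)"
    "lucas (6 * Suc q + 1) = 8 * lucas (6 * q) + 13 * lucas (6 * q + 1)"
    by (simp_all add: lucas_rec eval_nat_numeral)
  moreover have "(5 * a + 8 * b) mod 4 = (5 * 2 + 8 * 1) mod 4"
    "(8 * a + 13 * b) mod 4 = (8 * 2 + 13 * 1) mod 4"
    if "a mod 4 = 2" "b mod 4 = 1" for a b :: int
    by (intro mod_add_cong mod_mult_cong; simp add: that)+
  ultimately show ?case using Suc by simp
qed simp

lemma lucas_mod_4_eq_3:
  assumes "even k" "\<not> 3 dvd k"
  shows "lucas k mod 4 = 3"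
proof -
  have "k mod 6 = 2 \<or> k mod 6 = 4" using assms by presburger
  then obtain q where "k = 6 * q + 2 \<or> k = 6 * q + 4" by (metis mult_div_mod_eq)
  moreover have "lucas (6 * q + 2) = lucas (6 * q) + lucas (6 * q + 1)"
    "lucas (6 * q + 4) = 2 * lucas (6 * q) + 3 * lucas (6 * q + 1)"
    by (simp_all add: lucas_rec eval_nat_numeral)
  moreover have "(a + b) mod 4 = (2 + 1) mod 4" "(2 * a + 3 * b) mod 4 = (2 * 2 + 3 * 1) mod 4"
    if "a mod 4 = 2" "b mod 4 = 1" for a b :: int
    by (intro mod_add_cong mod_mult_cong; simp add: that)+
  ultimately show ?thesis using lucas_mod_4[of q] by auto
qed

text \<open>By \<open>lucas_square\<close>, a factor 5 would divide 4 up to sign.\<close>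

lemma not_5_dvd_lucas: "\<not> 5 dvd lucas n"
proof
  assume "5 dvd lucas n"
  then have "5 dvd (lucas n)\<^sup>2" by (simp add: power2_eq_square)
  then have "5 dvd 4 * (-1 :: int) ^ n" unfolding lucas_square by (subst (asm) dvd_add_right_iff) simp_all
  then show False by (cases "even n") simp_all
qed

section \<open>Odd indices\<close>

lemma fib_odd_eq_5_square:
  assumes "odd n" "int (fib n) = 5 * x\<^sup>2"
  shows "n = 5"
proof (rule ccontr)
  assume "n \<noteq> 5"
  \<comment> \<open>Excluding 1 ensures that \<open>n - 5\<close> is not truncated when
    \<open>n mod 4 = 1\<close>.\<close>
  have "n \<noteq> 1" using assms by (auto dest: arg_cong[where f = "\<lambda>i. i mod 5"])
  have "n \<noteq> 3"
    using assms by (auto dest: arg_cong[where f = "\<lambda>i. i mod 5"] simp: eval_nat_numeral)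
  obtain M where M: "M > 0" "even M" "n = 2 * M + 5 \<or> n + 5 = 2 * M"
  proof (cases "n mod 4 = 1")
    case True
    then have "n \<ge> 5" using \<open>n \<noteq> 1\<close> by presburger
    show ?thesis by (rule that[of "(n - 5) div 2"]) (use True \<open>n \<ge> 5\<close> \<open>n \<noteq> 5\<close> in presburger)+
  next
    case False
    then have "n mod 4 = 3" using assms(1) by presburger
    then obtain q where "n = 4 * q + 3" by (metis mult_div_mod_eq)
    then show ?thesis using that[of "2 * q + 4"] by simp
  qed
  \<comment> \<open>Removing all factors 3 gives \<open>lucas k\<close> residue 3 modulo 4; the
    removed power \<open>t\<close> is odd, so \<open>k\<close> stays even and the sign after
    \<open>t\<close> shifts is -1.\<close>
  obtain k where k: "M = k * 3 ^ multiplicity 3 M" "\<not> 3 dvd k"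
    using multiplicity_decompose'[of M 3] M by (auto simp: mult.commute)
  define t :: nat where "t = 3 ^ multiplicity 3 M"
  have t: "odd t" and Mk: "M = k * t" using k by (auto simp: t_def)
  have "even k" using M Mk t by simp
  have d0: "lucas k dvd int (fib (2 * M))"
    using lucas_dvd_fib_add_mult[OF \<open>even k\<close>, of 0 t] by (simp add: Mk mult.assoc)
  have d1: "lucas k dvd int (fib (Suc (2 * M))) + 1"
    using lucas_dvd_fib_add_mult[OF \<open>even k\<close>, of 1 t] t by (simp add: Mk mult.assoc)
  \<comment> \<open>Expand around index \<open>2 * M\<close>. In both cases F_(2M+1) has coefficient
    5, because F_5 = F_(-5) = 5; the other term vanishes modulo \<open>lucas k\<close>.\<close>
  have "int (fib n) = 3 * int (fib (2 * M)) + 5 * int (fib (Suc (2 * M)))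
     \<or> int (fib n) = 5 * int (fib (Suc (2 * M))) - 8 * int (fib (2 * M))"
    using M(3)
  proof
    assume "n = 2 * M + 5"
    then show ?thesis by (simp add: eval_nat_numeral)
  next
    assume "n + 5 = 2 * M"
    then have *: "2 * M = Suc (Suc (Suc (Suc (Suc n))))" by simp
    show ?thesis unfolding * by simp
  qed
  moreover have "lucas k dvd 5 * (int (fib (Suc (2 * M))) + 1)" using d1 by (rule dvd_mult)
  ultimately have "lucas k dvd int (fib n) + 5"
  proof (elim disjE)
    assume *: "int (fib n) = 3 * int (fib (2 * M)) + 5 * int (fib (Suc (2 * M)))"
    have "int (fib n) + 5 = 3 * int (fib (2 * M)) + 5 * (int (fib (Suc (2 * M))) + 1)"
      unfolding * by simp
    then show ?thesis using d0 d1 by (metis dvd_add dvd_mult)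
  next
    assume *: "int (fib n) = 5 * int (fib (Suc (2 * M))) - 8 * int (fib (2 * M))"
    have "int (fib n) + 5 = 5 * (int (fib (Suc (2 * M))) + 1) - 8 * int (fib (2 * M))"
      unfolding * by simp
    then show ?thesis using d0 d1 by (metis dvd_diff dvd_mult)
  qed
  then have "lucas k dvd 5 * (x\<^sup>2 + 1)" using assms(2) by (simp add: algebra_simps)
  moreover have "coprime (lucas k) 5"
    using not_5_dvd_lucas[of k] prime_imp_coprime[of 5 "lucas k"]
    by (simp add: coprime_commute)
  ultimately have "lucas k dvd x\<^sup>2 + 1" using coprime_dvd_mult_right_iff by blast
  then show False
    using not_dvd_square_add_one_of_mod_4_eq_3 lucas_pos lucas_mod_4_eq_3 \<open>even k\<close> k(2) by blast
qed

section \<open>Even indices: quartic obstructions and descent\<close>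

text \<open>By \<open>lucas_square\<close>, the square of the gcd divides 4.\<close>

lemma gcd_fib_lucas_dvd_2: "gcd (int (fib n)) (lucas n) dvd 2"
proof -
  let ?g = "gcd (int (fib n)) (lucas n)"
  have "?g\<^sup>2 dvd (lucas n)\<^sup>2" "?g\<^sup>2 dvd 5 * (int (fib n))\<^sup>2" by (simp_all add: dvd_mult)
  then have "?g\<^sup>2 dvd (lucas n)\<^sup>2 - 5 * (int (fib n))\<^sup>2" by (rule dvd_diff)
  then have "?g\<^sup>2 dvd 4 * (-1) ^ n" by (simp add: lucas_square)
  then have "?g\<^sup>2 dvd 2\<^sup>2" by (cases "even n") simp_all
  then show ?thesis by (simp only: pow_divides_pow_iff zero_less_numeral)
qed

lemma even_fib_iff_even_lucas: "even (int (fib n)) \<longleftrightarrow> even (lucas n)"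
  by (simp add: lucas_def)

text \<open>Fermat modulo 5; this fixes the parity of the index in both quartic equations of the
  descent.\<close>

lemma not_5_dvd_power4_add_one: "\<not> 5 dvd x ^ 4 + 1" for x :: int
proof -
  have "x mod 5 \<in> {0, 1, 2, 3, 4}" by simp presburger
  then have "x ^ 4 mod 5 = 0 \<or> x ^ 4 mod 5 = 1" using power_mod[of x 5 4] by auto
  then have "(x ^ 4 + 1) mod 5 \<noteq> 0" by presburger
  then show ?thesis by (simp add: dvd_eq_mod_eq_0)
qed

lemma power4_cases_16:
  fixes x :: int
  obtains q where "even x" "x ^ 4 = 16 * q" | q where "odd x" "x ^ 4 = 16 * q + 1"
proof (cases "even x")
  case True
  then obtain z where "x = 2 * z" by (rule evenE)
  then show ?thesis using that(1)[of "z ^ 4"] by simp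
next
  case False
  then obtain z where z: "x = 2 * z + 1" by (rule oddE)
  \<comment> \<open>The middle terms 24 z^2 + 8 z of the expansion equal 8 z (3 z + 1), a multiple
    of 16.\<close>
  have "even (z * (3 * z + 1))" by simp
  then obtain w where w: "z * (3 * z + 1) = 2 * w" by (rule evenE)
  have "x ^ 4 = 16 * (z ^ 4 + 2 * z ^ 3) + 8 * (z * (3 * z + 1)) + 1"
    unfolding z by (simp add: eval_nat_numeral algebra_simps)
  then have "x ^ 4 = 16 * (z ^ 4 + 2 * z ^ 3 + w) + 1"
    unfolding w by simp
  then show ?thesis using that(2) False by blast
qed

text \<open>For odd \<open>z\<close> the right side is 14 modulo 16, not a fourth power.\<close>

lemma even_of_power4_eq_1:
  fixes y z :: int
  assumes "y ^ 4 = 125 * z ^ 4 + 1"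
  shows "even z"
proof (rule ccontr)
  assume "odd z"
  then obtain q where q: "z ^ 4 = 16 * q + 1" by (metis power4_cases_16)
  obtain p where "y ^ 4 = 16 * p \<or> y ^ 4 = 16 * p + 1" by (metis power4_cases_16)
  then have "16 * (p - 125 * q) = 126 \<or> 16 * (p - 125 * q) = 125" using assms q by auto
  then have "(16 :: int) dvd 126 \<or> (16 :: int) dvd 125" by (metis dvd_triv_left)
  then show False by simp
qed

text \<open>Modulo 16 the left side is 0 or 4, the right side 15 or 12.\<close>

lemma four_power4_neq:
  fixes y z :: int
  shows "4 * y ^ 4 \<noteq> 125 * z ^ 4 - 1"
proof
  assume *: "4 * y ^ 4 = 125 * z ^ 4 - 1"
  obtain p where p: "y ^ 4 = 16 * p \<or> y ^ 4 = 16 * p + 1" by (metis power4_cases_16)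
  obtain q where q: "z ^ 4 = 16 * q \<or> z ^ 4 = 16 * q + 1" by (metis power4_cases_16)
  have "16 * (4 * p - 125 * q) \<in> {-1, -5, 124, 120}" using * p q by auto
  then have "(16 :: int) dvd -1 \<or> (16 :: int) dvd -5 \<or> (16 :: int) dvd 124 \<or> (16 :: int) dvd 120"
    by (metis dvd_triv_left empty_iff insert_iff)
  then show False by simp
qed

text \<open>Since \<open>lucas 5\<close> is 11, this stops the descent from reaching index 5, that
  is \<open>n = 10\<close>.\<close>

lemma square_neq_11: "t\<^sup>2 \<noteq> 11" for t :: int
proof
  assume "t\<^sup>2 = 11"
  then have "3 < \<bar>t\<bar>" "\<bar>t\<bar> < 4"
    using power_less_imp_less_base[of 3 2 "\<bar>t\<bar>"] power_less_imp_less_base[of "\<bar>t\<bar>" 2 4] by simp_all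
  then show False by linarith
qed

lemma five_dvd_fib:
  assumes "5 dvd int (fib n) * lucas n"
  shows "5 dvd int (fib n)"
  using assms not_5_dvd_lucas[of n] by (simp add: prime_dvd_mult_iff)

text \<open>The gcd is exactly 2 here, so halving both numbers leaves coprime ones.\<close>

lemma even_fib_lucasE:
  assumes "even (int (fib n))" "5 dvd int (fib n)"
  obtains a b where "int (fib n) = 10 * a" "lucas n = 2 * b" "coprime a b" "a \<ge> 0" "b \<ge> 0"
proof -
  have "10 dvd int (fib n)" using assms by presburger
  then obtain a where a: "int (fib n) = 10 * a" by blast
  obtain b where b: "lucas n = 2 * b"
    using assms(1) unfolding even_fib_iff_even_lucas by blast
  have "2 * gcd (5 * a) b dvd 2"
    using gcd_fib_lucas_dvd_2[of n] gcd_mult_distrib_int[of 2 "5 * a" b] by (simp add: a b)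
  then have "coprime (5 * a) b" by (simp add: coprime_iff_gcd_eq_1)
  then have "coprime a b" by simp
  moreover have "a \<ge> 0" using a by linarith
  moreover have "b \<ge> 0" using b lucas_pos[of n] by linarith
  ultimately show ?thesis using that a b by blast
qed

text \<open>If \<open>fib m\<close> is odd, it is again 5 times a square. If it is even, a second
  halving from \<open>m\<close> to \<open>j\<close> gives either a smaller solution or an impossible
  quartic.\<close>

lemma fib_eq_5_square_imp:
  assumes "int (fib n) = 5 * x\<^sup>2"
  shows "n = 0 \<or> n = 5"
  using assms
proof (induction n arbitrary: x rule: less_induct)
  case (less n)
  show ?case
  proof (cases "even n \<and> n \<noteq> 0")
    case False
    then show ?thesis using fib_odd_eq_5_square less.prems by blast
  next
    case True
    then have "n \<noteq> 0" by simp
    obtain m where m: "n = 2 * m" "m < n" using True by (auto elim: evenE)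
    have prod: "int (fib m) * lucas m = 5 * x\<^sup>2" using less.prems by (simp add: m fib_double)
    then have 5: "5 dvd int (fib m)" by (intro five_dvd_fib) simp
    show ?thesis
    proof (cases "even (int (fib m))")
      case False
      obtain a where a: "int (fib m) = 5 * a" using 5 by blast
      have "odd (gcd (int (fib m)) (lucas m))" using False by simp
      moreover have "gcd (int (fib m)) (lucas m) \<le> 2"
        using gcd_fib_lucas_dvd_2 by (rule zdvd_imp_le) simp
      moreover have "gcd (int (fib m)) (lucas m) \<ge> 0" by simp
      ultimately have "gcd (int (fib m)) (lucas m) = 1" by presburger
      then have "coprime (int (fib m)) (lucas m)" by (simp only: coprime_iff_gcd_eq_1)
      then have "coprime a (lucas m)" by (simp add: a)
      moreover have "a * lucas m = x\<^sup>2" using prod a by simp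
      moreover have "a \<ge> 0" using a by linarith
      ultimately obtain s t where st: "a = s\<^sup>2" "lucas m = t\<^sup>2"
        using lucas_pos[of m] coprime_mult_eq_square_int[of a "lucas m" x] by force
      then have "m = 0 \<or> m = 5" using less.IH[OF m(2)] a by simp
      moreover have "m \<noteq> 0" using True m(1) by simp
      ultimately show ?thesis using st(2) square_neq_11[of t] by (auto simp: lucas_5)
    next
      case True
      obtain a b where ab: "int (fib m) = 10 * a" "lucas m = 2 * b" "coprime a b" "a \<ge> 0" "b \<ge> 0"
        using even_fib_lucasE[OF True 5] .
      have x: "x\<^sup>2 = 4 * (a * b)" using prod ab by simp
      then have "even x" by (metis dvd_mult2 even_numeral even_power)
      then obtain w where "x = 2 * w" by (rule evenE)
      then have "a * b = w\<^sup>2" using x by (simp add: power2_eq_square)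
      then obtain z y where zy: "a = z\<^sup>2" "b = y\<^sup>2"
        using ab coprime_mult_eq_square_int by metis
      have eq: "y ^ 4 = 125 * z ^ 4 + (-1) ^ m"
        using lucas_square[of m] by (simp add: ab zy power2_eq_square power4_eq_xxxx)
      have "even m"
      proof (rule ccontr)
        assume "odd m"
        then have "y ^ 4 + 1 = 5 * (25 * z ^ 4)" using eq by simp
        then show False using not_5_dvd_power4_add_one[of y] by simp
      qed
      then obtain j where j: "m = 2 * j" by blast
      have "y ^ 4 = 125 * z ^ 4 + 1" using eq \<open>even m\<close> by simp
      \<comment> \<open>This extra factor 4 in \<open>fib m\<close> leads to
        \<open>c * d = 2 * v\<^sup>2\<close> after the next splitting.\<close>
      then have "even z" by (rule even_of_power4_eq_1)
      then obtain v where v: "z = 2 * v" by blast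
      have prod': "int (fib j) * lucas j = 40 * v\<^sup>2"
        using ab(1) by (simp add: j fib_double zy v power2_eq_square)
      then have 5: "5 dvd int (fib j)" by (intro five_dvd_fib) simp
      have "even (int (fib j) * lucas j)" using prod' by simp
      then have ev: "even (int (fib j))" using even_fib_iff_even_lucas[of j] by auto
      obtain c d where cd: "int (fib j) = 10 * c" "lucas j = 2 * d" "coprime c d" "c \<ge> 0" "d \<ge> 0"
        using even_fib_lucasE[OF ev 5] .
      have cdv: "c * d = 2 * v\<^sup>2" using prod' cd by simp
      then have "even c \<or> even d" by (metis even_mult_iff dvd_triv_left)
      then show ?thesis
      proof
        assume "even c"
        then obtain e where e: "c = 2 * e" by blast
        then have "e * d = v\<^sup>2" "coprime e d" "e \<ge> 0" using cdv cd by auto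
        then obtain s where "e = s\<^sup>2" using cd coprime_mult_eq_square_int by metis
        then have "int (fib j) = 5 * (2 * s)\<^sup>2" using cd e by (simp add: power2_eq_square)
        then have "j = 0 \<or> j = 5" using less.IH[of j "2 * s"] j m \<open>n \<noteq> 0\<close> by simp
        \<comment> \<open>\<open>fib 5\<close> is odd, while \<open>fib j\<close> is even.\<close>
        moreover have "j \<noteq> 5" using ev by (auto simp: fib_5)
        ultimately show ?thesis using j m by simp
      next
        assume "even d"
        then obtain e where e: "d = 2 * e" by blast
        then have "c * e = v\<^sup>2" "coprime c e" "e \<ge> 0" using cdv cd by auto
        then obtain s t where st: "c = s\<^sup>2" "e = t\<^sup>2" using cd coprime_mult_eq_square_int by metis
        have eq: "4 * t ^ 4 = 125 * s ^ 4 + (-1) ^ j"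
          using lucas_square[of j] by (simp add: cd e st power2_eq_square power4_eq_xxxx)
        have "odd j"
        proof
          assume "even j"
          \<comment> \<open>Subtract the quartic equation from \<open>5 * t ^ 4\<close>.\<close>
          then have "t ^ 4 + 1 = 5 * (t ^ 4 - 25 * s ^ 4)" using eq by simp
          then show False using not_5_dvd_power4_add_one[of t] by (metis dvd_triv_left)
        qed
        then have "4 * t ^ 4 = 125 * s ^ 4 - 1" using eq by simp
        then show ?thesis using four_power4_neq by blast
      qed
    qed
  qed
qed

theorem lemma3p3:
  fixes n :: nat and x :: int
  shows "int (fib n) = 5 * x ^ 2 \<longleftrightarrow> (n = 0 \<and> x = 0) \<or> (n = 5 \<and> (x = 1 \<or> x = -1))"
proof
  assume *: "int (fib n) = 5 * x ^ 2"
  then consider "n = 0" | "n = 5" using fib_eq_5_square_imp by blast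
  then show "(n = 0 \<and> x = 0) \<or> (n = 5 \<and> (x = 1 \<or> x = -1))"
    using * by cases (simp_all add: fib_5 power2_eq_1_iff)
next
  assume "(n = 0 \<and> x = 0) \<or> (n = 5 \<and> (x = 1 \<or> x = -1))"
  then show "int (fib n) = 5 * x ^ 2" by (auto simp: fib_5)
qed

end
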